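(* For every $\epsilon>0$, there is no weak consistent digital ray system (WCDR) in $\mathbb{Z}^2$ whose error in the $L_\infty$ metric is at most $1.5-\epsilon$.
   Context: Consider the unit grid graph on $\mathbb{Z}^2$: two points $p=(p_x,p_y)$, $q=(q_x,q_y)$ are adjacent iff $|p_x-q_x|+|p_y-q_y|=1$. Fix a root $o\in\mathbb{Z}^2$. A digital ray system $R_o$ assigns to every $p\in\mathbb{Z}^2$ a set $R_o(p)\subseteq\mathbb{Z}^2$. It is a weak consistent digital ray system (WCDR) if: (S1) for every $p$, $R_o(p)$ is the vertex set of a path from $o$ to $p$ in the grid graph; (S3) for every $p$ and every $q\in R_o(p)$, $R_o(q)\subseteq R_o(p)$; (S5) for every $p$, if $p_x=o_x$ then every $r\in R_o(p)$ has $r_x=o_x$, and if $p_y=o_y$ then every $r\in R_o(p)$ has $r_y=o_y$. The error of a segment is $E(R_o(p))=\max_{v\in R_o(p)} \mathrm{dist}_\infty(v,\overline{op})$, where $\overline{op}$ is the Euclidean segment from $o$ to $p$ and $\mathrm{dist}_\infty$ denotes $L_\infty$ distance from a point to a set. The error of the WCDR is $\sup_{p\in\mathbb{Z}^2}E(R_o(p))$. *)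

theory Defs
  imports "HOL-Analysis.Analysis"
begin

type_synonym pt = "int \<times> int"

definition grid_adj :: "pt \<Rightarrow> pt \<Rightarrow> bool" where
  "grid_adj p q \<longleftrightarrow> \<bar>fst p - fst q\<bar> + \<bar>snd p - snd q\<bar> = 1"

definition grid_path :: "pt list \<Rightarrow> pt \<Rightarrow> pt \<Rightarrow> bool" where
  "grid_path xs a b \<longleftrightarrow> xs \<noteq> [] \<and> hd xs = a \<and> last xs = b \<and> distinct xs \<and>
     (\<forall>i. Suc i < length xs \<longrightarrow> grid_adj (xs ! i) (xs ! Suc i))"

definition WCDR :: "pt \<Rightarrow> (pt \<Rightarrow> pt set) \<Rightarrow> bool" where
  "WCDR o' R \<longleftrightarrow>
     (\<forall>p. \<exists>xs. grid_path xs o' p \<and> R p = set xs) \<and>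
     (\<forall>p. \<forall>q\<in>R p. R q \<subseteq> R p) \<and>
     (\<forall>p. fst p = fst o' \<longrightarrow> (\<forall>r\<in>R p. fst r = fst o')) \<and>
     (\<forall>p. snd p = snd o' \<longrightarrow> (\<forall>r\<in>R p. snd r = snd o'))"

definition rpt :: "pt \<Rightarrow> real \<times> real" where
  "rpt p = (real_of_int (fst p), real_of_int (snd p))"

definition linf_dist :: "real \<times> real \<Rightarrow> real \<times> real \<Rightarrow> real" where
  "linf_dist u v = max \<bar>fst u - fst v\<bar> \<bar>snd u - snd v\<bar>"

definition linf_setdist :: "real \<times> real \<Rightarrow> (real \<times> real) set \<Rightarrow> real" where
  "linf_setdist u S = (INF w\<in>S. linf_dist u w)"

definition seg :: "pt \<Rightarrow> pt \<Rightarrow> (real \<times> real) set" where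
  "seg o' p = closed_segment (rpt o') (rpt p)"

definition seg_error :: "pt \<Rightarrow> pt \<Rightarrow> pt set \<Rightarrow> real" where
  "seg_error o' p S = (SUP v\<in>S. linf_setdist (rpt v) (seg o' p))"

definition WCDR_error :: "pt \<Rightarrow> (pt \<Rightarrow> pt set) \<Rightarrow> real" where
  "WCDR_error o' R = (SUP p. seg_error o' p (R p))"

end

theory Submission
  imports Defs
begin

text \<open>
  Every $R(p)$ contains a path from the root to $p$ such that these paths form a tree, so one may
  argue with ancestors. In a thin wedge along the $x$-axis, heights are measured relative to the
  direction of the wedge, and the $L_\infty$ error $e$ essentially bounds the difference in height
  between a point and those of its ancestors that are not much closer to the root. Take two points
  of the same far column whose last common ancestor $v$ is far out as well, but much closer to the
  root. Just before $v$ the common part of the two paths climbs along a vertical edge. Just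
  after $v$ the first branch climbs along a vertical edge too, and the second branch, being
  disjoint from it, meets the column of that edge at distance at least 2 from one of its ends. This
  gives two descendants of $v$ in one column, at distance at least 2; the upper one is at most
  $e$ above the lower end of the common edge, and the lower one is at most $e$ below its upper end.
  Hence $2 + 1 \le 2e$, up to an arbitrarily small correction. Two points with such a $v$ exist by
  pigeonhole, because the paths to the points of a far column all pass through the boundedly
  many wedge vertices of a fixed column.
\<close>

section \<open>Crossing columns along grid sequences\<close>

lemma grid_sequence_hits_column:
  fixes f :: "nat \<Rightarrow> pt"
  assumes step: "\<And>n. f (Suc n) = f n \<or> grid_adj (f n) (f (Suc n))"
    and "x \<le> fst (f 0)" "fst (f k) \<le> x"
  shows "\<exists>n\<le>k. fst (f n) = x"
  using assms(3)
proof (induction k)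
  case 0
  then show ?case using assms(2) by force
next
  case (Suc k)
  show ?case
  proof (cases "fst (f k) \<le> x")
    case True
    then show ?thesis using Suc.IH le_SucI by blast
  next
    case False
    have "fst (f k) - 1 \<le> fst (f (Suc k))"
      using step[of k] by (auto simp: grid_adj_def)
    with False Suc.prems have "fst (f (Suc k)) = x" by linarith
    then show ?thesis by blast
  qed
qed

text \<open>Without a vertical edge in the strip, every step there keeps its height, so a full
  crossing would meet the columns \<open>r\<close> and \<open>l\<close> on one level.\<close>

lemma grid_sequence_vertical_step:
  fixes f :: "nat \<Rightarrow> pt"
  assumes step: "\<And>n. f (Suc n) = f n \<or> grid_adj (f n) (f (Suc n))"
    and "l \<le> r" "r \<le> fst (f 0)" "fst (f k) \<le> l"
    and no_level: "\<And>i j y. i \<le> k \<Longrightarrow> j \<le> k \<Longrightarrow> f i = (r, y) \<Longrightarrow> f j \<noteq> (l, y)"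
  shows "\<exists>n<k. \<exists>x y. l \<le> x \<and> x \<le> r \<and> {f n, f (Suc n)} = {(x, y), (x, y + 1)}"
proof (rule ccontr)
  assume none: "\<not> ?thesis"
  have level: "snd (f (Suc n)) = snd (f n)"
    if "n < k" "l \<le> fst (f n)" "fst (f n) \<le> r" for n
  proof (rule ccontr)
    assume ne: "snd (f (Suc n)) \<noteq> snd (f n)"
    obtain x y x' y' where fn: "f n = (x, y)" "f (Suc n) = (x', y')"
      by (metis surj_pair)
    have "x' = x \<and> (y' = y + 1 \<or> y = y' + 1)"
      using step[of n] ne fn by (auto simp: grid_adj_def)
    then have "{f n, f (Suc n)} = {(x, min y y'), (x, min y y' + 1)}"
      using fn by auto
    with none that fn show False by (metis fst_conv)
  qed
  \<comment> \<open>Progress of a crossing without vertical edges: at or right of column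
    \<open>r\<close>, or inside on the level of a visit to column \<open>r\<close>, or both columns
    already met on one level. Going back to the right restarts it.\<close>
  have inv: "(r \<le> fst (f n)) \<or> (l < fst (f n) \<and> fst (f n) \<le> r \<and> (\<exists>i\<le>n. f i = (r, snd (f n))))
      \<or> (\<exists>i\<le>n. \<exists>j\<le>n. \<exists>y. f i = (r, y) \<and> f j = (l, y))" if "n \<le> k" for n
    using that
  proof (induction n)
    case 0
    then show ?case using assms(3) by simp
  next
    case (Suc n)
    have st: "\<bar>fst (f (Suc n)) - fst (f n)\<bar> \<le> 1"
      using step[of n] by (auto simp: grid_adj_def)
    consider "r \<le> fst (f (Suc n))"
      | "\<exists>i\<le>n. \<exists>j\<le>n. \<exists>y. f i = (r, y) \<and> f j = (l, y)"
      | "fst (f (Suc n)) < r" "l < fst (f n)" "fst (f n) \<le> r" "\<exists>i\<le>n. f i = (r, snd (f n))"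
      | "fst (f (Suc n)) < r" "r \<le> fst (f n)"
      using Suc by (metis Suc_leD not_le)
    then show ?case
    proof cases
      case 2
      then show ?thesis by (metis le_SucI)
    next
      case 3
      then obtain i where i: "i \<le> n" "f i = (r, snd (f n))" by blast
      have sn: "snd (f (Suc n)) = snd (f n)" using level[of n] 3 Suc.prems by simp
      have "l \<le> fst (f (Suc n))" using st 3 by linarith
      then show ?thesis
        using 3 i sn by (metis le_SucI order.order_iff_strict order.refl prod.collapse)
    next
      case 4
      then have fr: "fst (f n) = r" using st by linarith
      show ?thesis
      proof (cases "l = r")
        case True
        then have "f n = (r, snd (f n)) \<and> f n = (l, snd (f n))" using fr by (metis prod.collapse)
        then show ?thesis by (metis le_SucI order.refl)
      next
        case False
        have sn: "snd (f (Suc n)) = snd (f n)"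
          using level[of n] 4 fr Suc.prems \<open>l \<le> r\<close> by simp
        have i: "f n = (r, snd (f n))" using fr by (metis prod.collapse)
        have "l \<le> fst (f (Suc n))" using st 4 False \<open>l \<le> r\<close> by linarith
        then show ?thesis
          using 4 i sn by (metis le_SucI order.order_iff_strict order.refl prod.collapse)
      qed
    qed simp
  qed
  from inv[OF order.refl] show False
  proof (elim disjE)
    assume "r \<le> fst (f k)"
    then have "f k = (r, snd (f k))" "f k = (l, snd (f k))"
      using assms(2,4) by (auto simp: prod_eq_iff)
    then show False using no_level by blast
  qed (use assms(4) no_level in auto)
qed

section \<open>Ancestor chains in a tree with small error\<close>

text \<open>
  The iterates of \<open>par\<close> lead from a point back to the origin; \<open>window\<close> is implied by an $L_\infty$
  error of at most \<open>E\<close> and is written without division.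
\<close>

locale narrow_grid_tree =
  fixes par :: "pt \<Rightarrow> pt" and E :: real
  assumes par_step: "par p = p \<or> grid_adj p (par p)"
    and reaches_root: "\<exists>n. (par ^^ n) p = (0, 0)"
    and window: "0 < X \<Longrightarrow> 0 \<le> Y \<Longrightarrow> (par ^^ n) (X, Y) = (a, b) \<Longrightarrow>
      \<bar>of_int b * of_int X - of_int a * of_int Y\<bar> \<le> E * (of_int X + of_int Y)"
    and E_nonneg: "0 \<le> E" and E_less: "E < 3/2"
begin

lemma chain_step: "(par ^^ Suc n) p = (par ^^ n) p \<or> grid_adj ((par ^^ n) p) ((par ^^ Suc n) p)"
  using par_step by simp

text \<open>Adding the two window inequalities gives x + a(z - y) <= E(2x + y + z). The gap
  contributes 2 and the edge 1, so 3 <= 2E once x - a and y are small against x.\<close>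

lemma common_vertical_edge_bound:
  assumes "0 < x" "0 \<le> y" "y + 2 \<le> z" and "2 * E \<le> of_int a"
    and "(par ^^ i) (x, y) = (a, b + 1)" and "(par ^^ j) (x, z) = (a, b)"
  shows "(3 - 2 * E) * of_int x \<le> 2 * (of_int x - of_int a) + 2 * E * (of_int y + 1)"
proof -
  have 1: "of_int (b + 1) * of_int x - of_int a * of_int y \<le> E * (real_of_int x + of_int y)"
    using window[OF _ _ assms(5)] assms(1,2) by linarith
  have 2: "of_int a * of_int z - of_int b * of_int x \<le> E * (real_of_int x + of_int z)"
    using window[OF _ _ assms(6)] assms(1,2,3) by linarith
  \<comment> \<open>With E z moved to the left, \<open>z\<close> has the nonnegative coefficient
    \<open>a - E\<close>, so it can be lowered to \<open>y + 2\<close>.\<close>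
  have "(of_int a - E) * (of_int y + 2) \<le> (of_int a - E) * real_of_int z"
    using assms(3,4) E_nonneg by (intro mult_left_mono) linarith+
  with 1 2 show ?thesis by (simp add: algebra_simps)
qed

text \<open>The chain is stopped just before its first step to the left of column \<open>c\<close>;
  a step changes the abscissa by at most 1, so this happens in column \<open>c\<close>.\<close>

lemma last_exit:
  assumes "0 < c" "c \<le> fst p"
  obtains k z where "(par ^^ k) p = (c, z)" "\<And>i. i \<le> k \<Longrightarrow> c \<le> fst ((par ^^ i) p)"
proof -
  define m where "m = (LEAST n. fst ((par ^^ n) p) < c)"
  have ex: "\<exists>n. fst ((par ^^ n) p) < c"
    using reaches_root[of p] assms(1) by (metis fst_conv)
  have m: "fst ((par ^^ m) p) < c"
    unfolding m_def using ex by (rule LeastI_ex)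
  have before: "c \<le> fst ((par ^^ i) p)" if "i < m" for i
    using not_less_Least[of i "\<lambda>n. fst ((par ^^ n) p) < c"] that by (simp add: m_def)
  obtain k where k: "m = Suc k"
    using m assms(2) by (cases m) auto
  have "fst ((par ^^ k) p) \<le> fst ((par ^^ Suc k) p) + 1"
    using chain_step[of k p] by (auto simp: grid_adj_def)
  then have "fst ((par ^^ k) p) = c"
    using m before[of k] k by simp
  then have "(par ^^ k) p = (c, snd ((par ^^ k) p))"
    by (metis prod.collapse)
  then show thesis
    using that before k by (metis less_Suc_eq_le)
qed

lemma chain_add: "(par ^^ n) ((par ^^ m) p) = (par ^^ (m + n)) p"
  by (metis add.commute comp_apply funpow_add)

lemma first_common_ancestor:
  assumes "(par ^^ k) p \<in> range (\<lambda>n. (par ^^ n) q)"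
  obtains i j where "i \<le> k" "(par ^^ i) p = (par ^^ j) q"
    "\<And>i' j'. i' < i \<Longrightarrow> (par ^^ i') p \<noteq> (par ^^ j') q"
proof -
  define i where "i = (LEAST n. (par ^^ n) p \<in> range (\<lambda>n. (par ^^ n) q))"
  have "(par ^^ i) p \<in> range (\<lambda>n. (par ^^ n) q)"
    unfolding i_def using assms by (rule LeastI)
  moreover have "i \<le> k"
    unfolding i_def using assms by (rule Least_le)
  moreover have "(par ^^ i') p \<notin> range (\<lambda>n. (par ^^ n) q)" if "i' < i" for i'
    using not_less_Least that unfolding i_def by blast
  ultimately show thesis using that by blast
qed

end

section \<open>Ancestors of points in column \<open>N\<close> with slopes between 1/q and
  2/q\<close>

locale grid_tree_wedge = narrow_grid_tree +
  fixes q L N :: int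
  assumes q: "4 \<le> q" and L: "64 \<le> L" and N: "N = q * L"
begin

text \<open>The window inequality divided by \<open>L\<close>: up to constants, b lies between a/q
  and 2a/q. The hypothesis \<open>2 \<le> a\<close> makes \<open>a - E\<close> positive, so
  \<open>Y\<close> can be lowered to \<open>L\<close>.\<close>

lemma wedge_bounds:
  assumes "L \<le> Y" "Y \<le> 2 * L" "(par ^^ n) (N, Y) = (a, b)" "2 \<le> a"
  shows "of_int q * of_int b \<le> 2 * (of_int a + E) + E * of_int q"
    and "of_int a - E \<le> of_int q * of_int b + E * of_int q"
proof -
  have Np: "0 < N" using q L N by simp
  have w: "\<bar>of_int b * of_int N - of_int a * of_int Y\<bar> \<le> E * (real_of_int N + of_int Y)"
    using window[OF Np _ assms(3)] assms(1) L by simp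
  have Lp: "0 < real_of_int L" using L by simp
  have "(of_int a + E) * of_int Y \<le> (of_int a + E) * (2 * real_of_int L)"
    using assms E_nonneg by (intro mult_left_mono) linarith+
  with w have "(of_int q * of_int b) * real_of_int L \<le> (2 * (of_int a + E) + E * of_int q) * of_int L"
    by (simp add: N algebra_simps)
  then show "of_int q * of_int b \<le> 2 * (of_int a + E) + E * of_int q"
    using Lp by (simp only: mult_le_cancel_right_pos)
  have "(of_int a - E) * real_of_int L \<le> (of_int a - E) * of_int Y"
    using assms E_less by (intro mult_left_mono) linarith+
  with w have "(of_int a - E) * real_of_int L \<le> (of_int q * of_int b + E * of_int q) * of_int L"
    by (simp add: N algebra_simps)
  then show "of_int a - E \<le> of_int q * of_int b + E * of_int q"
    using Lp by (simp only: mult_le_cancel_right_pos)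
qed

text \<open>Over \<open>4 * q\<close> columns the segment to \<open>(N, Y)\<close> rises by 4qY/N,
  whereas two ancestors on one level allow at most 3(1 + Y/N). As N <= qY, this would force q <=
  3.\<close>

lemma no_long_level:
  assumes "L \<le> Y" "(par ^^ i) (N, Y) = (a + 4 * q, y)"
  shows "(par ^^ j) (N, Y) \<noteq> (a, y)"
proof
  assume j: "(par ^^ j) (N, Y) = (a, y)"
  have Np: "0 < N" using q L N by simp
  have "of_int (a + 4 * q) * of_int Y - of_int y * of_int N \<le> E * (real_of_int N + of_int Y)"
    using window[OF Np _ assms(2)] assms(1) L by linarith
  moreover have "of_int y * of_int N - of_int a * of_int Y \<le> E * (real_of_int N + of_int Y)"
    using window[OF Np _ j] assms(1) L by linarith
  ultimately have "4 * of_int q * real_of_int Y \<le> 2 * E * (of_int N + of_int Y)"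
    by (simp add: algebra_simps)
  also have "\<dots> \<le> 3 * (of_int N + real_of_int Y)"
    using E_less Np assms(1) L by (intro mult_right_mono) auto
  also have "of_int N \<le> of_int q * real_of_int Y"
    using assms(1) q by (simp add: N)
  finally have "of_int q * real_of_int Y \<le> 3 * of_int Y" by (simp add: algebra_simps)
  then show False using assms(1) L q by simp
qed

text \<open>In column \<open>c\<close> the two segments are c(Y2 - Y1)/N apart, which the errors
  must bridge; hence 8c <= 3N + 6L. This leaves room for a strip of width \<open>4 * q\<close> to
  the right of the branch point.\<close>

lemma branch_point_bounded:
  assumes Y: "L \<le> Y\<^sub>1" "Y\<^sub>1 + 8 \<le> Y\<^sub>2" "Y\<^sub>2 \<le> 2 * L"
    and i: "(par ^^ i) (N, Y\<^sub>1) = (c, h)" and j: "(par ^^ j) (N, Y\<^sub>2) = (c, h)" and "0 \<le> c"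
  shows "c + 1 + 4 * q \<le> N"
proof -
  have Np: "0 < N" using q L N by simp
  have "of_int h * of_int N - of_int c * of_int Y\<^sub>1 \<le> E * (real_of_int N + of_int Y\<^sub>1)"
    using window[OF Np _ i] Y L by linarith
  moreover have "of_int c * of_int Y\<^sub>2 - of_int h * of_int N \<le> E * (real_of_int N + of_int Y\<^sub>2)"
    using window[OF Np _ j] Y L by linarith
  ultimately have "of_int c * (of_int Y\<^sub>2 - of_int Y\<^sub>1) \<le> E * (2 * of_int N + of_int Y\<^sub>1 + real_of_int Y\<^sub>2)"
    by (simp add: algebra_simps)
  also have "\<dots> \<le> 3/2 * (2 * of_int N + of_int Y\<^sub>1 + real_of_int Y\<^sub>2)"
    using E_less Np Y L by (intro mult_right_mono) auto
  also have "\<dots> \<le> 3 * of_int N + 6 * of_int L" using Y by simp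
  finally have "of_int c * (of_int Y\<^sub>2 - of_int Y\<^sub>1) \<le> 3 * of_int N + 6 * real_of_int L" .
  moreover have "of_int c * 8 \<le> of_int c * (real_of_int Y\<^sub>2 - of_int Y\<^sub>1)"
    using Y \<open>0 \<le> c\<close> by (intro mult_left_mono) auto
  ultimately have "real_of_int (c * 8) \<le> real_of_int (3 * N + 6 * L)" by simp
  then have "8 * c \<le> 3 * N + 6 * L" by (simp only: of_int_le_iff)
  moreover have "4 * L \<le> N" using q L by (simp add: N)
  moreover have "64 * q \<le> N" using q L by (simp add: N)
  ultimately show ?thesis using q by linarith
qed

text \<open>By \<open>no_long_level\<close> the common path from \<open>(c, h)\<close> to the root
  has a vertical edge within \<open>4 * q\<close> columns. Both points descend from both of its
  ends, so \<open>common_vertical_edge_bound\<close> applies.\<close>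

lemma no_close_common_ancestor:
  assumes Y: "L \<le> Y\<^sub>1" "Y\<^sub>1 \<le> 2 * L" "L \<le> Y\<^sub>2" "Y\<^sub>2 \<le> 2 * L"
    and w1: "(par ^^ i\<^sub>1) (N, Y\<^sub>1) = (x, y)" and w2: "(par ^^ i\<^sub>2) (N, Y\<^sub>2) = (x, z)"
    and "y + 2 \<le> z"
    and v1: "(par ^^ j\<^sub>1) (x, y) = (c, h)" and v2: "(par ^^ j\<^sub>2) (x, z) = (c, h)"
    and c: "8 * q \<le> c" "c < x" "x \<le> c + 1 + 4 * q"
    and small_slope: "6 \<le> (3/2 - E) * of_int q"
    and far: "16 * of_int q + 20 < (3/2 - E) * of_int c"
  shows False
proof -
  obtain k where k: "(par ^^ k) (c, h) = (0, 0)" using reaches_root by blast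
  have "\<exists>n<k. \<exists>a b. c - 4 * q \<le> a \<and> a \<le> c \<and>
      {(par ^^ n) (c, h), (par ^^ Suc n) (c, h)} = {(a, b), (a, b + 1)}"
  proof (rule grid_sequence_vertical_step)
    fix i j y'
    assume "(par ^^ i) (c, h) = (c, y')"
    then have "(par ^^ (i\<^sub>1 + j\<^sub>1 + i)) (N, Y\<^sub>1) = (c - 4 * q + 4 * q, y')"
      using w1 v1 by (simp add: chain_add[symmetric])
    from no_long_level[OF Y(1) this, of "i\<^sub>1 + j\<^sub>1 + j"]
    show "(par ^^ j) (c, h) \<noteq> (c - 4 * q, y')"
      using w1 v1 by (simp add: chain_add[symmetric])
  qed (use chain_step k c q in auto)
  then obtain a b n\<^sub>1 n\<^sub>2 where ab: "c - 4 * q \<le> a" "a \<le> c"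
    "(par ^^ n\<^sub>1) (c, h) = (a, b)" "(par ^^ n\<^sub>2) (c, h) = (a, b + 1)"
    by (metis doubleton_eq_iff)
  \<comment> \<open>The lower point is paired with the upper end and the upper point with the lower
    end; the direction of the edge does not matter.\<close>
  have top: "(par ^^ (j\<^sub>1 + n\<^sub>2)) (x, y) = (a, b + 1)"
    and bot: "(par ^^ (j\<^sub>2 + n\<^sub>1)) (x, z) = (a, b)"
    using ab v1 v2 by (simp_all add: chain_add[symmetric])
  have x2: "2 \<le> x" using c q by linarith
  note yb = wedge_bounds[OF Y(1,2) w1 x2]
  have q4: "4 \<le> real_of_int q" using q by simp
  have xq: "8 * real_of_int q \<le> real_of_int x" using c by linarith
  have Eq: "E * of_int q \<le> 3/2 * real_of_int q"
    using E_less q4 by (intro mult_right_mono) auto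
  have "0 < of_int q * real_of_int y" using yb(2) Eq xq q4 E_less by linarith
  then have y0: "0 \<le> y" using q4 by (simp add: zero_less_mult_iff)
  have a2: "2 * E \<le> of_int a" using ab(1) c q E_less by linarith
  have "(3 - 2 * E) * of_int x \<le> 2 * (of_int x - of_int a) + 2 * E * (of_int y + 1)"
    by (rule common_vertical_edge_bound[OF _ y0 \<open>y + 2 \<le> z\<close> a2 top bot]) (use x2 in simp)
  moreover have "2 * E * (of_int y + 1) \<le> 3 * (real_of_int y + 1)"
    using E_less y0 by (intro mult_right_mono) auto
  moreover have "real_of_int x - of_int a \<le> 8 * of_int q + 1" using ab c by linarith
  ultimately have "(3 - 2 * E) * of_int x \<le> 2 * (8 * of_int q + 1) + 3 * (real_of_int y + 1)"
    by argo
  then have main: "(3 - 2 * E) * of_int x \<le> 16 * of_int q + 5 + 3 * real_of_int y"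
    by argo
  \<comment> \<open>The wedge gives 3y about 6x/q at most, and \<open>small_slope\<close> reduces
    this to half of the left side of \<open>main\<close>, up to a constant.\<close>
  have "of_int q * (3 * real_of_int y) \<le> of_int q * ((3/2 - E) * of_int x + 15)"
  proof -
    have "6 * real_of_int x \<le> ((3/2 - E) * of_int q) * of_int x"
      using small_slope x2 by (intro mult_right_mono) auto
    moreover have "of_int q * ((3/2 - E) * of_int x + 15)
        = ((3/2 - E) * of_int q) * of_int x + 15 * real_of_int q"
      by (simp add: algebra_simps)
    moreover have "of_int q * (3 * real_of_int y) \<le> 6 * of_int x + 9 + 9/2 * of_int q"
      using yb(1) Eq E_less by argo
    ultimately show ?thesis using q4 by argo
  qed
  then have "3 * real_of_int y \<le> (3/2 - E) * of_int x + 15"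
    using q4 by (simp only: mult_le_cancel_left_pos)
  with main have "(3/2 - E) * real_of_int x \<le> 16 * of_int q + 20"
    by (simp add: algebra_simps)
  moreover have "(3/2 - E) * real_of_int c \<le> (3/2 - E) * of_int x"
    using E_less c by (intro mult_left_mono) auto
  ultimately show False using far by linarith
qed

lemma no_distant_common_ancestor:
  assumes Y: "L \<le> Y\<^sub>1" "Y\<^sub>1 + 8 \<le> Y\<^sub>2" "Y\<^sub>2 \<le> 2 * L"
    and small_slope: "6 \<le> (3/2 - E) * of_int q"
    and far: "16 * of_int q + 20 < (3/2 - E) * of_int X" and X: "8 * q \<le> X"
    and k: "\<And>n. n \<le> k \<Longrightarrow> X \<le> fst ((par ^^ n) (N, Y\<^sub>1))"
  shows "(par ^^ k) (N, Y\<^sub>1) \<noteq> (par ^^ l) (N, Y\<^sub>2)"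
proof
  assume "(par ^^ k) (N, Y\<^sub>1) = (par ^^ l) (N, Y\<^sub>2)"
  then have "(par ^^ k) (N, Y\<^sub>1) \<in> range (\<lambda>n. (par ^^ n) (N, Y\<^sub>2))" by blast
  then obtain i j where ij: "i \<le> k" "(par ^^ i) (N, Y\<^sub>1) = (par ^^ j) (N, Y\<^sub>2)"
    "\<And>i' j'. i' < i \<Longrightarrow> (par ^^ i') (N, Y\<^sub>1) \<noteq> (par ^^ j') (N, Y\<^sub>2)"
    by (rule first_common_ancestor) blast
  obtain c h where ch: "(par ^^ i) (N, Y\<^sub>1) = (c, h)" by (metis surj_pair)
  have chj: "(par ^^ j) (N, Y\<^sub>2) = (c, h)" using ij ch by simp
  have Xc: "X \<le> c" using k[OF ij(1)] ch by simp
  have cN: "c + 1 + 4 * q \<le> N"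
    by (rule branch_point_bounded[OF Y ch chj]) (use Xc X q in linarith)
  \<comment> \<open>The strip starts at \<open>c + 1\<close>, so both ends of the edge come strictly
    before the meeting point and are missed by the second chain.\<close>
  have "\<exists>n<i. \<exists>x y. c + 1 \<le> x \<and> x \<le> c + 1 + 4 * q \<and>
      {(par ^^ n) (N, Y\<^sub>1), (par ^^ Suc n) (N, Y\<^sub>1)} = {(x, y), (x, y + 1)}"
    by (rule grid_sequence_vertical_step)
      (use chain_step no_long_level[OF Y(1)] cN q ch in auto)
  then obtain n x y where n: "n < i" and x: "c + 1 \<le> x" "x \<le> c + 1 + 4 * q"
    and xy: "{(par ^^ n) (N, Y\<^sub>1), (par ^^ Suc n) (N, Y\<^sub>1)} = {(x, y), (x, y + 1)}"
    by blast
  have "fst ((par ^^ Suc n) (N, Y\<^sub>1)) = x" using xy by (metis doubleton_eq_iff fst_conv)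
  then have "Suc n \<noteq> i" using ch x by auto
  with n have n': "Suc n < i" by simp
  obtain n\<^sub>1 n\<^sub>2 where low: "n\<^sub>1 < i" "(par ^^ n\<^sub>1) (N, Y\<^sub>1) = (x, y)"
    and high: "n\<^sub>2 < i" "(par ^^ n\<^sub>2) (N, Y\<^sub>1) = (x, y + 1)"
    using xy n n' by (metis doubleton_eq_iff)
  have "\<exists>m\<le>j. fst ((par ^^ m) (N, Y\<^sub>2)) = x"
    by (rule grid_sequence_hits_column) (use chain_step x cN chj in auto)
  then obtain m z where m: "m \<le> j" "(par ^^ m) (N, Y\<^sub>2) = (x, z)"
    by (metis prod.collapse)
  have z: "z \<noteq> y" "z \<noteq> y + 1"
    using ij(3)[OF low(1), of m] ij(3)[OF high(1), of m] low high m by auto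
  have to_v: "(par ^^ (i - n')) (x, y') = (c, h)"
    if "n' < i" "(par ^^ n') (N, Y\<^sub>1) = (x, y')" for n' y'
    using that ch chain_add[of "i - n'" n' "(N, Y\<^sub>1)"] by simp
  have to_v2: "(par ^^ (j - m)) (x, z) = (c, h)"
    using m chj chain_add[of "j - m" m "(N, Y\<^sub>2)"] by simp
  have "(3/2 - E) * real_of_int X \<le> (3/2 - E) * of_int c"
    using E_less Xc by (intro mult_left_mono) auto
  with far have far': "16 * of_int q + 20 < (3/2 - E) * real_of_int c" by linarith
  have c: "8 * q \<le> c" "c < x" using X Xc x by simp_all
  have Y': "Y\<^sub>1 \<le> 2 * L" "L \<le> Y\<^sub>2" using Y by linarith+
  \<comment> \<open>Whichever side of the edge \<open>z\<close> lies on, its distance to the farther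
    end is at least 2.\<close>
  consider "y + 2 \<le> z" | "z + 2 \<le> y + 1" using z by linarith
  then show False
  proof cases
    case 1
    show False
      by (rule no_close_common_ancestor[OF Y(1) Y'(1) Y'(2) Y(3) low(2) m(2) 1
            to_v[OF low] to_v2 c x(2) small_slope far'])
  next
    case 2
    show False
      by (rule no_close_common_ancestor[OF Y'(2) Y(3) Y(1) Y'(1) m(2) high(2) 2
            to_v2 to_v[OF high] c x(2) small_slope far'])
  qed
qed

end

section \<open>Choice of parameters and pigeonhole\<close>

context narrow_grid_tree
begin

lemma impossible: False
proof -
  define d where "d = 3/2 - E"
  have d: "0 < d" using E_less by (simp add: d_def)
  \<comment> \<open>First \<open>q\<close> makes the slopes small against \<open>d\<close>, then
    \<open>X\<close> makes errors of order q negligible; \<open>J\<close>, \<open>L\<close> and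
    \<open>N\<close> follow.\<close>
  define q :: int where "q = max 4 \<lceil>6 / d\<rceil>"
  have q: "4 \<le> q" and "6 / d \<le> of_int q" unfolding q_def by (simp, linarith)
  then have small_slope: "6 \<le> (3/2 - E) * of_int q"
    using d by (simp add: d_def field_simps)
  define X :: int where "X = max (8 * q) (\<lfloor>(16 * of_int q + 20) / d\<rfloor> + 1)"
  have X: "8 * q \<le> X" and "(16 * of_int q + 20) / d < of_int X" unfolding X_def by (simp, linarith)
  then have far: "16 * of_int q + 20 < (3/2 - E) * of_int X"
    using d by (simp add: d_def field_simps)
  \<comment> \<open>There are J + 1 = X + 11 starting points, more than the X + 9 possible heights
    in column \<open>X\<close>. With \<open>L = 8 * int J\<close>, starts spaced by 8 reach at most
    \<open>2 * L\<close>.\<close>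
  define J where "J = nat (X + 10)"
  define L :: int where "L = 8 * int J"
  define N where "N = q * L"
  have L: "64 \<le> L" using X q by (simp add: L_def J_def)
  interpret grid_tree_wedge par E q L N
    by unfold_locales (use q L N_def in auto)
  define Y where "Y t = L + 8 * int t" for t :: nat
  have LN: "L \<le> N" using q L by (simp add: N_def)
  have XN: "X \<le> N" using LN q X by (simp add: L_def J_def)
  have "\<exists>k z. (par ^^ k) (N, Y t) = (X, z) \<and> (\<forall>i\<le>k. X \<le> fst ((par ^^ i) (N, Y t)))" for t
    by (rule last_exit[of X "(N, Y t)"]) (use X q XN in auto)
  then obtain k z where kz: "\<And>t. (par ^^ k t) (N, Y t) = (X, z t)"
    "\<And>t i. i \<le> k t \<Longrightarrow> X \<le> fst ((par ^^ i) (N, Y t))" by metis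
  have "z t \<in> {-2..X + 6}" if "t \<le> J" for t
  proof -
    have Yt: "L \<le> Y t" "Y t \<le> 2 * L" using that by (auto simp: Y_def L_def)
    have X2: "2 \<le> X" using X q by linarith
    note b = wedge_bounds[OF Yt kz(1) X2]
    have q4: "4 \<le> real_of_int q" using q by simp
    have Eq: "E * of_int q \<le> 3/2 * real_of_int q"
      using E_less q4 by (intro mult_right_mono) auto
    have "of_int q * (- 2) < of_int q * real_of_int (z t)"
      using b(2) Eq q4 E_less X2 by linarith
    then have "- 2 < real_of_int (z t)"
      using q4 by (simp only: mult_less_cancel_left_pos)
    then have "- 2 < z t" by linarith
    moreover have "of_int q * real_of_int (z t) \<le> of_int q * real_of_int (X + 6)"
    proof -
      have "4 * real_of_int X \<le> of_int q * of_int X"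
        using q4 X2 by (intro mult_right_mono) auto
      moreover have "of_int q * real_of_int (X + 6) = of_int q * of_int X + 6 * of_int q"
        by (simp add: algebra_simps)
      moreover have "of_int q * real_of_int (z t) \<le> 2 * of_int X + 3 + 3/2 * of_int q"
        using b(1) Eq E_less by argo
      moreover have "2 \<le> real_of_int X" using X2 by simp
      ultimately show ?thesis using q4 by argo
    qed
    then have "z t \<le> X + 6" using q4 by (simp only: mult_le_cancel_left_pos of_int_le_iff)
    ultimately show ?thesis by simp
  qed
  then have "z ` {..J} \<subseteq> {-2..X + 6}" by blast
  then have "card (z ` {..J}) \<le> card {-2..X + 6}" by (intro card_mono) auto
  also have "\<dots> < card {..J}" using X q by (simp add: J_def)
  finally have "\<not> inj_on z {..J}" by (rule pigeonhole)
  then obtain s t where "s \<le> J" "t \<le> J" "s < t" "z s = z t"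
    unfolding inj_on_def by (metis atMost_iff linorder_neqE_nat)
  then have "(par ^^ k s) (N, Y s) \<noteq> (par ^^ k t) (N, Y t)"
    by (intro no_distant_common_ancestor[OF _ _ _ small_slope far X kz(2)]) (auto simp: Y_def L_def)
  with \<open>z s = z t\<close> show False by (simp add: kz(1))
qed

end

section \<open>From digital ray systems to trees\<close>

text \<open>A suitable parent of \<open>p\<close> is its predecessor on a shortest path inside
  \<open>R p\<close>. By (S3) all ancestors stay in \<open>R p\<close>, and a lexicographic measure
  excludes cycles.\<close>

lemma WCDR_parent_map:
  assumes "WCDR o' R"
  obtains par where "par o' = o'" "\<And>p. p \<noteq> o' \<Longrightarrow> grid_adj p (par p)"
    "\<And>p n. (par ^^ n) p \<in> R p" "\<And>p. \<exists>n. (par ^^ n) p = o'"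
proof -
  have path: "\<exists>xs. grid_path xs o' p \<and> R p = set xs" for p
    using assms unfolding WCDR_def by blast
  have sub: "R q \<subseteq> R p" if "q \<in> R p" for p q
    using assms that unfolding WCDR_def by blast
  have fin: "finite (R p)" for p using path[of p] by auto
  have self: "p \<in> R p" for p
    using path[of p] by (auto simp: grid_path_def)
  define len where
    "len p = (LEAST n. \<exists>xs. grid_path xs o' p \<and> set xs \<subseteq> R p \<and> length xs = n)" for p
  define \<mu> where "\<mu> p = (card (R p), len p)" for p
  \<comment> \<open>\<open>R q = R p\<close> is possible for \<open>q \<noteq> p\<close>, so the cardinality alone need not decrease.\<close>
  have "\<exists>q\<in>R p. grid_adj p q \<and> (\<mu> q, \<mu> p) \<in> less_than <*lex*> less_than" if "p \<noteq> o'" for p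
  proof -
    have "\<exists>xs. grid_path xs o' p \<and> set xs \<subseteq> R p \<and> length xs = len p"
      unfolding len_def by (rule LeastI_ex) (use path[of p] in auto)
    then obtain xs where xs: "grid_path xs o' p" "set xs \<subseteq> R p" "length xs = len p" by blast
    obtain ys where ys: "xs = ys @ [p]"
      using xs(1) by (metis append_butlast_last_id grid_path_def)
    have "ys \<noteq> []" using xs(1) ys that by (auto simp: grid_path_def)
    then obtain zs q where zs: "ys = zs @ [q]" by (metis rev_exhaust)
    have adj: "grid_adj q p"
    proof -
      have "Suc (length zs) < length xs" by (simp add: ys zs)
      then have "grid_adj (xs ! length zs) (xs ! Suc (length zs))"
        using xs(1) unfolding grid_path_def by blast
      moreover have "xs ! length zs = q" "xs ! Suc (length zs) = p"
        using nth_append_length[of zs q "[p]"] nth_append_length[of ys p "[]"] by (simp_all add: ys zs)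
      ultimately show ?thesis by simp
    qed
    have "grid_adj (ys ! i) (ys ! Suc i)" if "Suc i < length ys" for i
    proof -
      have "grid_adj (xs ! i) (xs ! Suc i)"
        using xs(1) that by (simp add: grid_path_def ys)
      then show ?thesis using that by (simp add: ys nth_append)
    qed
    then have ys_path: "grid_path ys o' q"
      using xs(1) by (auto simp: grid_path_def ys zs hd_append split: if_splits)
    have q: "q \<in> R p" using xs(2) by (simp add: ys zs)
    \<comment> \<open>If the rays agree, deleting \<open>p\<close> leaves a shorter path inside
      \<open>R q\<close>; otherwise \<open>R q\<close> is a proper subset of
      \<open>R p\<close>.\<close>
    have "(\<mu> q, \<mu> p) \<in> less_than <*lex*> less_than"
    proof (cases "R q = R p")
      case True
      then have "len q \<le> length ys"
        unfolding len_def using ys_path xs(2) ys by (intro Least_le) auto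
      then show ?thesis using xs(3) True by (simp add: \<mu>_def ys)
    next
      case False
      then have "card (R q) < card (R p)"
        using sub[OF q] fin by (simp add: psubset_card_mono psubset_eq)
      then show ?thesis by (simp add: \<mu>_def)
    qed
    then show ?thesis using q adj by (auto simp: grid_adj_def abs_minus_commute)
  qed
  then obtain f where f: "\<And>p. p \<noteq> o' \<Longrightarrow> f p \<in> R p \<and> grid_adj p (f p)
      \<and> (\<mu> (f p), \<mu> p) \<in> less_than <*lex*> less_than" by metis
  define par where "par = f(o' := o')"
  have in_R: "(par ^^ n) p \<in> R p" for n p
  proof (induction n)
    case 0
    then show ?case by (simp add: self)
  next
    case (Suc n)
    have "par ((par ^^ n) p) \<in> R ((par ^^ n) p)"
      using f self by (auto simp: par_def)
    then show ?case using sub[OF Suc] by auto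
  qed
  have root: "\<exists>n. (par ^^ n) p = o'" for p
  proof -
    have "wf (inv_image (less_than <*lex*> less_than) \<mu>)" by (simp add: wf_lex_prod)
    then show ?thesis
    proof (induction p rule: wf_induct_rule)
      case (less p)
      show ?case
      proof (cases "p = o'")
        case True
        then show ?thesis by (metis funpow_0)
      next
        case False
        then have "(f p, p) \<in> inv_image (less_than <*lex*> less_than) \<mu>"
          using f by (simp add: in_inv_image)
        then obtain n where "(par ^^ n) (f p) = o'" using less by blast
        then have "(par ^^ Suc n) p = o'"
          using False by (simp add: par_def funpow_swap1)
        then show ?thesis by blast
      qed
    qed
  qed
  show thesis
    using that[of par] in_R root f by (simp add: par_def)
qed

text \<open>Strictness yields a segment point within \<open>E\<close> directly from the infimum;
  \<open>s\<close> is its parameter after the root is moved to the origin.\<close>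

lemma linf_setdist_segment_less:
  assumes "linf_setdist (rpt (v + o')) (seg o' (p + o')) < E"
  shows "\<exists>s. \<bar>of_int (fst v) - s * of_int (fst p)\<bar> < E \<and> \<bar>of_int (snd v) - s * of_int (snd p)\<bar> < E"
proof -
  obtain w where w: "w \<in> seg o' (p + o')" "linf_dist (rpt (v + o')) w < E"
    using cInf_lessD[OF _ assms[unfolded linf_setdist_def]] by (auto simp: seg_def)
  obtain s where "w = (1 - s) *\<^sub>R rpt o' + s *\<^sub>R rpt (p + o')"
    using w(1) by (auto simp: seg_def in_segment)
  then have "of_int (fst (v + o')) - fst w = real_of_int (fst v) - s * of_int (fst p)"
    "of_int (snd (v + o')) - snd w = real_of_int (snd v) - s * of_int (snd p)"
    by (simp_all add: rpt_def algebra_simps)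
  moreover have "\<bar>of_int (fst (v + o')) - fst w\<bar> < E" "\<bar>of_int (snd (v + o')) - snd w\<bar> < E"
    using w(2) by (simp_all add: linf_dist_def rpt_def)
  ultimately show ?thesis by metis
qed

theorem theorem2:
  fixes \<epsilon> :: real and o' :: pt
  assumes "\<epsilon> > 0"
  shows "\<not> (\<exists>R. WCDR o' R \<and> bdd_above (range (\<lambda>p. seg_error o' p (R p)))
                 \<and> WCDR_error o' R \<le> 1.5 - \<epsilon>)"
proof
  assume "\<exists>R. WCDR o' R \<and> bdd_above (range (\<lambda>p. seg_error o' p (R p)))
                 \<and> WCDR_error o' R \<le> 1.5 - \<epsilon>"
  then obtain R where R: "WCDR o' R" and bdd: "bdd_above (range (\<lambda>p. seg_error o' p (R p)))"
    and err: "WCDR_error o' R \<le> 1.5 - \<epsilon>" by blast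
  obtain par where par: "par o' = o'" "\<And>p. p \<noteq> o' \<Longrightarrow> grid_adj p (par p)"
    "\<And>p n. (par ^^ n) p \<in> R p" "\<And>p. \<exists>n. (par ^^ n) p = o'"
    by (rule WCDR_parent_map[OF R]) blast
  \<comment> \<open>Halfway between the assumed error and 3/2: the distances in \<open>close\<close>
    become strict, and still \<open>E < 3/2\<close>.\<close>
  define E where "E = 3/2 - \<epsilon> / 2"
  have close: "linf_setdist (rpt v) (seg o' p) < E" if "v \<in> R p" for v p
  proof -
    have "finite (R p)" using R unfolding WCDR_def by (metis finite_set)
    then have "linf_setdist (rpt v) (seg o' p) \<le> seg_error o' p (R p)"
      unfolding seg_error_def using that by (intro cSUP_upper bdd_above_finite) auto
    also have "\<dots> \<le> WCDR_error o' R"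
      unfolding WCDR_error_def using bdd by (intro cSUP_upper) auto
    finally show ?thesis using err assms by (simp add: E_def)
  qed
  define par' where "par' p = par (p + o') - o'" for p
  have par'_pow: "(par' ^^ n) p = (par ^^ n) (p + o') - o'" for n p
    by (induction n) (simp_all add: par'_def)
  interpret narrow_grid_tree par' E
  proof
    show "par' p = p \<or> grid_adj p (par' p)" for p
      using par(1) par(2)[of "p + o'"]
      by (cases "p + o' = o'") (auto simp: par'_def grid_adj_def algebra_simps)
    show "\<exists>n. (par' ^^ n) p = (0, 0)" for p
      using par(4)[of "p + o'"] unfolding par'_pow by (metis diff_self zero_prod_def)
    show "\<bar>of_int b * of_int X - of_int a * of_int Y\<bar> \<le> E * (of_int X + of_int Y)"
      if "0 < X" "0 \<le> Y" "(par' ^^ n) (X, Y) = (a, b)" for X Y n a b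
    proof -
      have "(a, b) + o' \<in> R ((X, Y) + o')"
        using par(3)[of n "(X, Y) + o'"] that(3) by (simp add: par'_pow diff_eq_eq)
      from linf_setdist_segment_less[OF close[OF this]] obtain s
        where s: "\<bar>of_int a - s * of_int X\<bar> < E" "\<bar>of_int b - s * of_int Y\<bar> < E" by auto
      \<comment> \<open>The cross product with \<open>(X, Y)\<close> eliminates
        \<open>s\<close>.\<close>
      have "of_int b * of_int X - of_int a * of_int Y
          = (of_int b - s * of_int Y) * of_int X - (of_int a - s * of_int X) * real_of_int Y"
        by (simp add: algebra_simps)
      also have "\<bar>\<dots>\<bar> \<le> \<bar>of_int b - s * of_int Y\<bar> * of_int X + \<bar>of_int a - s * of_int X\<bar> * real_of_int Y"
        using that(1,2) by (intro order_trans[OF abs_triangle_ineq4]) (simp add: abs_mult)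
      also have "\<dots> \<le> E * of_int X + E * of_int Y"
        using s that(1,2) by (intro add_mono mult_right_mono) auto
      finally show ?thesis by (simp add: algebra_simps)
    qed
    have "o' \<in> R o'" using par(3)[of 0 o'] by simp
    then show "0 \<le> E"
      using linf_setdist_segment_less[of 0 o' 0 E] close by fastforce
    show "E < 3/2" using assms by (simp add: E_def)
  qed
  show False by (rule impossible)
qed

end
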